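(* Let $A$ be an $m\times m$ real matrix of rank $r$ and let $1\le n\le m$. Assume that the vectors $\mathbf{x}_1,\ldots,\mathbf{x}_n\in\mathbb{R}^m$ are orthonormal, define $\mathbf{y}_i:=A^T\mathbf{x}_i$ for $i=1,\ldots,n$, and let $\mathbb{X}_n:=\mathrm{span}\{\mathbf{x}_1,\ldots,\mathbf{x}_n\}$. Then $$\Big\|A-\sum_{i=1}^n\mathbf{x}_i\mathbf{y}_i^T\Big\| = E(\mathcal{A},\mathbb{X}_n).$$ Consequently, if $n<r$ and the singular values of $A$ satisfy $\sigma_n>\sigma_{n+1}>\sigma_{n+2}\ge 0$, the matrix $\sum_{i=1}^n\mathbf{x}_i\mathbf{y}_i^T$ is a best rank-$n$ approximation to $A$ if and only if the subspace $\mathbb{X}_n$ is optimal for $\mathcal{A}$.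
   Context: $\|\cdot\|$ denotes the Euclidean norm on $\mathbb{R}^m$ and the induced operator (spectral) norm on matrices. The singular values of $A$ are $\sigma_1\ge\cdots\ge\sigma_r>\sigma_{r+1}=\cdots=\sigma_m=0$, with the convention $\sigma_{m+1}:=0$. Set $\mathcal{A}:=\{A\mathbf{x}:\mathbf{x}\in\mathbb{R}^m,\ \|\mathbf{x}\|\le1\}$. For a subspace $\mathbb{X}$ of $\mathbb{R}^m$, $E(\mathcal{A},\mathbb{X}):=\max_{\mathbf{a}\in\mathcal{A}}\min_{\mathbf{x}\in\mathbb{X}}\|\mathbf{a}-\mathbf{x}\|$. The Kolmogorov $n$-width is $d_n(\mathcal{A}):=\min_{\mathbb{X}_n}E(\mathcal{A},\mathbb{X}_n)$, the minimum being over all $n$-dimensional subspaces $\mathbb{X}_n$ of $\mathbb{R}^m$; an $n$-dimensional subspace $\mathbb{X}_n$ is called optimal for $\mathcal{A}$ if $E(\mathcal{A},\mathbb{X}_n)=d_n(\mathcal{A})$. For $n<r$, a best rank-$n$ approximation to $A$ is an $m\times m$ real matrix $R_n$ of rank $n$ such that $\|A-R_n\|\le\|A-B\|$ for every $m\times m$ real matrix $B$ of rank $n$. *)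

theory Defs
  imports
    "HOL-Analysis.Analysis"
    "HOL-Computational_Algebra.Polynomial"
    "HOL-Library.Multiset"
begin

definition spectral_norm :: "real^'m^'m \<Rightarrow> real" where
  "spectral_norm A = onorm (\<lambda>x. A *v x)"

definition outer_product :: "real^'m \<Rightarrow> real^'m \<Rightarrow> real^'m^'m" where
  "outer_product x y = (\<chi> i j. x $ i * y $ j)"

definition char_polynomial :: "real^'m^'m \<Rightarrow> real poly" where
  "char_polynomial M = det (\<chi> i j. (if i = j then [:0, 1:] else 0) - [:M $ i $ j:])"

text \<open>
  The singular values are the square roots of the eigenvalues of the transpose of \<open>A\<close> times \<open>A\<close>,
  counted with multiplicity and listed in decreasing order, with indices starting at 1.
  That matrix is symmetric and positive semidefinite, so all roots of its characteristic
  polynomial are real and nonnegative and the list has length \<open>CARD('m)\<close>. Beyond the last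
  index the value is 0 by convention; the value at index 0 is irrelevant.
\<close>

definition singular_value :: "real^'m^'m \<Rightarrow> nat \<Rightarrow> real" where
  "singular_value A k =
    (if 1 \<le> k \<and> k \<le> CARD('m)
     then sqrt (rev (sorted_list_of_multiset
            (proots (char_polynomial (transpose A ** A)))) ! (k - 1))
     else 0)"

definition unit_ball_image :: "real^'m^'m \<Rightarrow> (real^'m) set" where
  "unit_ball_image A = {A *v x | x. norm x \<le> 1}"

text \<open>
  Supremum and infimum in \<open>deviation\<close> are a maximum and a minimum when \<open>S\<close> is nonempty and
  compact and \<open>X\<close> is a subspace, see the two lemmas below. The infimum in \<open>kolmogorov_width\<close>
  is over a set that is bounded below by 0, and nonempty whenever \<open>n \<le> CARD('m)\<close>.
\<close>

definition deviation :: "(real^'m) set \<Rightarrow> (real^'m) set \<Rightarrow> real" where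
  "deviation S X = (SUP a\<in>S. INF x\<in>X. norm (a - x))"

definition kolmogorov_width :: "nat \<Rightarrow> (real^'m) set \<Rightarrow> real" where
  "kolmogorov_width n S = (INF X\<in>{X. subspace X \<and> dim X = n}. deviation S X)"

definition optimal_subspace :: "nat \<Rightarrow> (real^'m) set \<Rightarrow> (real^'m) set \<Rightarrow> bool" where
  "optimal_subspace n S X \<longleftrightarrow>
    subspace X \<and> dim X = n \<and> deviation S X = kolmogorov_width n S"

definition best_rank_approximation :: "nat \<Rightarrow> real^'m^'m \<Rightarrow> real^'m^'m \<Rightarrow> bool" where
  "best_rank_approximation n A R \<longleftrightarrow>
    rank R = n \<and>
    (\<forall>B. rank B = n \<longrightarrow> spectral_norm (A - R) \<le> spectral_norm (A - B))"

lemma deviation_inner_min: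
  fixes a :: "real^'m"
  assumes "subspace X"
  obtains x where "x \<in> X" "(INF x\<in>X. norm (a - x)) = norm (a - x)"
    "\<forall>z\<in>X. norm (a - x) \<le> norm (a - z)"
proof -
  have ne: "X \<noteq> {}" using assms subspace_0 by blast
  obtain x where x: "x \<in> X" "infdist a X = dist a x"
    using infdist_attains_inf[OF closed_subspace[OF assms] ne] by blast
  have "\<forall>z\<in>X. norm (a - x) \<le> norm (a - z)"
    using infdist_le[of _ X a] x by (metis dist_norm)
  moreover have "(INF x\<in>X. norm (a - x)) = norm (a - x)"
    using x ne by (simp add: infdist_notempty dist_norm)
  ultimately show thesis using x that by blast
qed

lemma deviation_max:
  fixes S :: "(real^'m) set"
  assumes "compact S" "S \<noteq> {}" "subspace X"
  obtains a where "a \<in> S" "deviation S X = (INF x\<in>X. norm (a - x))"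
    "\<forall>b\<in>S. (INF x\<in>X. norm (b - x)) \<le> (INF x\<in>X. norm (a - x))"
proof -
  have ne: "X \<noteq> {}" using assms(3) subspace_0 by blast
  have eq: "(INF x\<in>X. norm (a - x)) = infdist a X" for a
    using ne by (simp add: infdist_notempty dist_norm)
  obtain a where a: "a \<in> S" "\<forall>b\<in>S. infdist b X \<le> infdist a X"
    using continuous_attains_sup[OF assms(1,2), of "\<lambda>b. infdist b X"]
      continuous_on_infdist[OF continuous_on_id] by blast
  have "deviation S X = infdist a X"
    unfolding deviation_def eq using a by (intro cSup_eq_maximum) auto
  then show thesis using a that eq by simp
qed

lemma compact_unit_ball_image: "compact (unit_ball_image A)"
proof -
  have "unit_ball_image A = (\<lambda>x. A *v x) ` cball 0 1"
    by (auto simp: unit_ball_image_def)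
  then show ?thesis
    by (simp add: compact_continuous_image linear_continuous_on)
qed

end

theory Submission
  imports Defs
begin

text \<open>
  With \<open>P\<close> the orthogonal projection onto \<open>X\<close>, the sum of the outer products is \<open>P A\<close>, and
  \<open>\<parallel>(A - P A) z\<parallel>\<close> is the distance of \<open>A z\<close> from \<open>X\<close>; this gives the norm identity. Moreover the
  deviation of the range of any \<open>B\<close> is at most \<open>\<parallel>A - B\<parallel>\<close>, so minimizing over subspaces and over
  matrices of rank \<open>n\<close> is the same problem, except that \<open>P A\<close> may have rank less than \<open>n\<close>. The gap
  \<open>\<sigma>\<^sub>n > \<sigma>\<^sub>n\<^sub>+\<^sub>1\<close> excludes this for a minimizer: a matrix of rank below \<open>n\<close> has error at
  least \<open>\<sigma>\<^sub>n\<close>, whereas the truncated singular value decomposition has rank \<open>n\<close> and error at most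
  \<open>\<sigma>\<^sub>n\<^sub>+\<^sub>1\<close>.
\<close>

section \<open>Spectral theorem for self-adjoint maps\<close>

text \<open>Near \<open>t = 0\<close> the linear term dominates and changes sign with
  \<open>t\<close>. This is the first-order condition at a maximum in algebraic form, free of
  derivatives.\<close>

lemma quadratic_nonneg_linear_zero:
  fixes a b :: real
  assumes "0 \<le> a" and "\<And>t. 0 \<le> a * t\<^sup>2 + 2 * b * t"
  shows "b = 0"
proof (rule ccontr)
  assume "b \<noteq> 0"
  \<comment> \<open>The minimizer would be \<open>- b / a\<close>; the denominator
    \<open>a + 1\<close> stays positive also for \<open>a = 0\<close> and still gives a negative
    value.\<close>
  have "a * (- b / (a + 1))\<^sup>2 + 2 * b * (- b / (a + 1)) = - (b\<^sup>2 * (a + 2)) / (a + 1)\<^sup>2"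
    using assms(1) by (simp add: divide_simps) (simp add: power2_eq_square algebra_simps)
  also have "\<dots> < 0"
    using assms(1) \<open>b \<noteq> 0\<close> by (simp add: divide_simps mult_pos_pos)
  finally show False
    using assms(2)[of "- b / (a + 1)"] by simp
qed

text \<open>A maximizer of the quadratic form on the unit sphere of \<open>S\<close> is an eigenvector.\<close>

lemma selfadjoint_eigenvector:
  fixes f :: "'a::euclidean_space \<Rightarrow> 'a"
  assumes "linear f" and sa: "\<And>x y. f x \<bullet> y = x \<bullet> f y"
    and S: "subspace S" and inv: "f ` S \<subseteq> S" and "S \<noteq> {0}"
  obtains v c where "v \<in> S" "norm v = 1" "f v = c *\<^sub>R v"
proof -
  interpret f: linear f by fact
  have ne: "S \<inter> sphere 0 1 \<noteq> {}"
  proof -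
    obtain z where "z \<in> S" "z \<noteq> 0"
      using \<open>S \<noteq> {0}\<close> subspace_0[OF S] by auto
    then have "z /\<^sub>R norm z \<in> S \<inter> sphere 0 1"
      using S by (simp add: subspace_scale)
    then show ?thesis by blast
  qed
  have "compact (S \<inter> sphere 0 1)"
    using closed_subspace[OF S] by (simp add: closed_Int_compact)
  moreover have "continuous_on (S \<inter> sphere 0 1) (\<lambda>x. x \<bullet> f x)"
    by (intro continuous_intros linear_continuous_on linear_linear[THEN iffD2] \<open>linear f\<close>)
  ultimately obtain v where v: "v \<in> S" "norm v = 1"
    and max: "\<And>x. x \<in> S \<Longrightarrow> norm x = 1 \<Longrightarrow> x \<bullet> f x \<le> v \<bullet> f v"
    using continuous_attains_sup[OF _ ne, of "\<lambda>x. x \<bullet> f x"] by auto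
  define c where "c = v \<bullet> f v"
  \<comment> \<open>Homogeneity of degree 2 extends the bound from the unit sphere of
    \<open>S\<close> to all of \<open>S\<close>, with equality at \<open>v\<close>.\<close>
  have form: "x \<bullet> f x \<le> c * (x \<bullet> x)" if "x \<in> S" for x
  proof (cases "x = 0")
    case False
    have "(x /\<^sub>R norm x) \<bullet> f (x /\<^sub>R norm x) \<le> c"
      unfolding c_def using that False S by (intro max) (auto simp: subspace_scale)
    moreover have "(x /\<^sub>R norm x) \<bullet> f (x /\<^sub>R norm x) = (x \<bullet> f x) / (x \<bullet> x)"
      by (simp add: f.scaleR divide_inverse dot_square_norm power2_eq_square)
    ultimately have "(x \<bullet> f x) / (x \<bullet> x) \<le> c"
      by simp
    then show ?thesis
      using False by (simp add: divide_simps split: if_splits)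
  qed (simp add: f.zero)
  \<comment> \<open>The residual serves as the direction of variation: invariance keeps it in
    \<open>S\<close>, and in \<open>form\<close> at \<open>v + t *\<^sub>R u\<close> the constant
    terms cancel while the linear coefficient becomes \<open>2 * (u \<bullet> u)\<close>. Hence the
    residual must vanish.\<close>
  define u where "u = c *\<^sub>R v - f v"
  have u: "u \<in> S"
    unfolding u_def using S v inv by (intro subspace_diff subspace_scale) auto
  have "0 \<le> (c * (u \<bullet> u) - u \<bullet> f u) * t\<^sup>2 + 2 * (u \<bullet> u) * t" for t
  proof -
    have eq: "v \<bullet> v = 1" using v by (simp add: norm_eq_1)
    have le: "(v + t *\<^sub>R u) \<bullet> f (v + t *\<^sub>R u) \<le> c * ((v + t *\<^sub>R u) \<bullet> (v + t *\<^sub>R u))"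
      using S u v by (intro form subspace_add subspace_scale)
    have e1: "(v + t *\<^sub>R u) \<bullet> f (v + t *\<^sub>R u) = c + 2 * t * (f v \<bullet> u) + t\<^sup>2 * (u \<bullet> f u)"
      using sa[of v u] by (simp add: f.add f.scaleR inner_simps c_def inner_commute power2_eq_square)
    have e2: "(v + t *\<^sub>R u) \<bullet> (v + t *\<^sub>R u) = 1 + 2 * t * (v \<bullet> u) + t\<^sup>2 * (u \<bullet> u)"
      using eq by (simp add: inner_simps inner_commute power2_eq_square)
    have e3: "2 * (u \<bullet> u) * t = c * (2 * t * (v \<bullet> u)) - 2 * t * (f v \<bullet> u)"
      by (subst (1) u_def) (simp add: inner_diff_left algebra_simps)
    show ?thesis
      using le unfolding e1 e2 e3 by (simp add: algebra_simps)
  qed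
  then have "u \<bullet> u = 0"
    using form[OF u] by (intro quadratic_nonneg_linear_zero[of "c * (u \<bullet> u) - u \<bullet> f u"]) auto
  then have "f v = c *\<^sub>R v"
    by (simp add: u_def)
  then show thesis using v that by blast
qed

text \<open>Induction on the dimension: split off one eigenvector \<open>v\<close> and continue in
  the orthogonal complement of \<open>v\<close> within \<open>S\<close>, which \<open>f\<close>
  preserves because it is self-adjoint. Writing the eigenvalue of a unit vector as
  \<open>b \<bullet> f b\<close> avoids choosing an eigenvalue for each \<open>b\<close>.\<close>

lemma selfadjoint_orthonormal_eigenbasis:
  fixes f :: "'a::euclidean_space \<Rightarrow> 'a"
  assumes "linear f" and sa: "\<And>x y. f x \<bullet> y = x \<bullet> f y"
    and "subspace S" and "f ` S \<subseteq> S"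
  shows "\<exists>B\<subseteq>S. pairwise orthogonal B \<and> (\<forall>b\<in>B. norm b = 1 \<and> f b = (b \<bullet> f b) *\<^sub>R b) \<and>
           card B = dim S \<and> finite B"
  using assms(3,4)
proof (induction "dim S" arbitrary: S)
  case 0
  then show ?case
    by (intro exI[of _ "{}"]) auto
next
  case (Suc k S)
  interpret f: linear f by fact
  have "S \<noteq> {0}" using Suc.hyps(2) by auto
  then obtain v c where v: "v \<in> S" "norm v = 1" "f v = c *\<^sub>R v"
    using selfadjoint_eigenvector[OF \<open>linear f\<close> sa Suc.prems] by metis
  have vv: "v \<bullet> v = 1" using v by (simp add: norm_eq_1)
  define T where "T = {y \<in> S. v \<bullet> y = 0}"
  have subT: "subspace T"
    using Suc.prems(1) by (auto simp: T_def subspace_def inner_add_right)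
  have "{y \<in> S. \<forall>x\<in>span {v}. orthogonal x y} = T"
    by (auto simp: T_def span_singleton orthogonal_def dest: bspec[where x="1 *\<^sub>R v"])
  then have "dim T + dim (span {v}) = dim S"
    using dim_subspace_orthogonal_to_vectors[OF subspace_span Suc.prems(1), of "{v}"] v
      Suc.prems(1) by (simp add: span_minimal)
  moreover have "v \<noteq> 0" using v by auto
  ultimately have dimT: "dim T = k" using Suc.hyps(2) by simp
  have "f ` T \<subseteq> T"
  proof
    fix z assume "z \<in> f ` T"
    then obtain y where y: "y \<in> S" "v \<bullet> y = 0" "z = f y" by (auto simp: T_def)
    have "v \<bullet> f y = f v \<bullet> y" using sa by simp
    then show "z \<in> T" using y v Suc.prems(2) by (auto simp: T_def)
  qed
  then obtain B where B: "B \<subseteq> T" "pairwise orthogonal B" "card B = dim T" "finite B"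
    "\<forall>b\<in>B. norm b = 1 \<and> f b = (b \<bullet> f b) *\<^sub>R b"
    using Suc.hyps(1)[OF dimT[symmetric] subT] by blast
  have "v \<notin> B" using B(1) vv by (auto simp: T_def)
  moreover have "pairwise orthogonal (insert v B)"
    using B(1,2) by (auto simp: pairwise_insert orthogonal_def T_def inner_commute)
  moreover have "f v = (v \<bullet> f v) *\<^sub>R v" using v vv by simp
  moreover have "insert v B \<subseteq> S" using B(1) v by (auto simp: T_def)
  ultimately show ?case
    using B v dimT Suc.hyps(2) by (intro exI[of _ "insert v B"]) auto
qed

section \<open>Characteristic polynomial from an eigenbasis\<close>

lemma poly_det: "poly (det M) t = det (\<chi> i j. poly (M $ i $ j) t)"
  by (simp add: det_def poly_sum poly_mult poly_prod)

lemma poly_char_polynomial: "poly (char_polynomial M) t = det (mat t - M)"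
proof -
  have "(\<chi> i j. poly ((\<chi> i j. (if i = j then [:0, 1:] else 0) - [:M $ i $ j:]) $ i $ j) t) = mat t - M"
    by (simp add: vec_eq_iff mat_def)
  then show ?thesis
    by (simp add: char_polynomial_def poly_det)
qed

text \<open>Conjugation by the orthogonal matrix of eigenvectors makes \<open>mat t - M\<close>
  diagonal without changing its determinant; agreement at all real \<open>t\<close> gives equality
  of polynomials. The factorization yields the roots with their multiplicities, as the definition of
  singular values requires.\<close>

lemma char_polynomial_eigenbasis:
  fixes M :: "real^'m^'m" and B :: "(real^'m) set"
  assumes orth: "pairwise orthogonal B" and norm: "\<And>b. b \<in> B \<Longrightarrow> norm b = 1"
    and eig: "\<And>b. b \<in> B \<Longrightarrow> M *v b = d b *\<^sub>R b" and card: "card B = CARD('m)"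
  shows "char_polynomial M = (\<Prod>b\<in>B. [:- d b, 1:])"
proof -
  have "finite B" using card by (metis card.infinite zero_less_card_finite less_irrefl)
  then obtain q :: "'m \<Rightarrow> real^'m" where q: "bij_betw q UNIV B"
    using finite_same_card_bij[OF finite, of B UNIV] card by auto
  have qB: "q i \<in> B" for i using q by (auto simp: bij_betw_def)
  have on: "q i \<bullet> q j = (if i = j then 1 else 0)" for i j
  proof -
    have "q i \<noteq> q j" if "i \<noteq> j"
      using that q by (auto simp: bij_betw_def dest: injD)
    then show ?thesis
      using orth norm[OF qB] qB by (auto simp: pairwise_def orthogonal_def norm_eq_1)
  qed
  \<comment> \<open>The columns of \<open>Q\<close> are the basis vectors, so
    \<open>transpose Q ** N ** Q\<close> is the matrix of \<open>N\<close> in this basis.\<close>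
  define Q :: "real^'m^'m" where "Q = transpose (\<chi> i. q i)"
  have entry: "(transpose Q ** N ** Q) $ i $ j = q i \<bullet> (N *v q j)" for N i j
    unfolding Q_def by (simp add: matrix_mul_assoc[symmetric])
      (simp add: matrix_matrix_mult_def transpose_def matrix_vector_mult_def inner_vec_def)
  have "transpose Q ** mat 1 ** Q = mat 1"
    unfolding vec_eq_iff entry by (simp add: on) (simp add: mat_def)
  then have dQ: "det (transpose Q) * det Q = 1"
    by (metis det_I det_mul matrix_mul_rid)
  have "poly (char_polynomial M) t = poly (\<Prod>b\<in>B. [:- d b, 1:]) t" for t
  proof -
    have e: "(transpose Q ** (mat t - M) ** Q) $ i $ j = (if i = j then t - d (q i) else 0)" for i j
    proof -
      have "mat t *v q j = t *\<^sub>R q j"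
        by (simp add: vec_eq_iff matrix_vector_mult_def mat_def if_distrib if_distribR cong: if_cong)
      then show ?thesis
        unfolding entry by (simp add: matrix_vector_mult_diff_rdistrib eig[OF qB] inner_diff_right on)
    qed
    have "det (mat t - M) = det (transpose Q ** (mat t - M) ** Q)"
      using dQ by (simp add: det_mul mult.commute)
    also have "\<dots> = (\<Prod>i\<in>UNIV. (transpose Q ** (mat t - M) ** Q) $ i $ i)"
      by (rule det_diagonal) (simp add: e)
    also have "\<dots> = (\<Prod>i\<in>UNIV. t - d (q i))"
      by (simp add: e)
    also have "\<dots> = (\<Prod>b\<in>B. t - d b)"
      using prod.reindex_bij_betw[OF q] .
    finally show ?thesis
      by (simp add: poly_char_polynomial poly_prod)
  qed
  then show ?thesis
    by (simp add: poly_eq_poly_eq_iff[symmetric] ext)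
qed

section \<open>Singular values and right singular vectors\<close>

lemma inner_gram:
  fixes A :: "real^'m^'n"
  shows "((transpose A ** A) *v x) \<bullet> y = (A *v x) \<bullet> (A *v y)"
  by (simp add: transpose_matrix_vector dot_lmul_matrix flip: matrix_vector_mul_assoc)

text \<open>The \<open>v i\<close> are right singular vectors: orthonormal eigenvectors of
  \<open>transpose A ** A\<close>, listed by decreasing eigenvalue. The lemma replaces the
  definition through polynomial roots by geometry; all later facts about singular values are drawn
  from it.\<close>

lemma singular_basis:
  fixes A :: "real^'m^'m"
  obtains v :: "nat \<Rightarrow> real^'m" where
    "\<forall>i\<in>{1..CARD('m)}. \<forall>j\<in>{1..CARD('m)}. v i \<bullet> v j = (if i = j then 1 else 0)"
    "\<forall>i\<in>{1..CARD('m)}. \<forall>j\<in>{1..CARD('m)}.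
       (A *v v i) \<bullet> (A *v v j) = (if i = j then (singular_value A i)\<^sup>2 else 0)"
    "\<And>k. singular_value A k \<ge> 0"
    "\<And>j k. 1 \<le> j \<Longrightarrow> j \<le> k \<Longrightarrow> singular_value A k \<le> singular_value A j"
proof -
  let ?M = "transpose A ** A"
  obtain B :: "(real^'m) set" where B: "pairwise orthogonal B" "card B = CARD('m)" "finite B"
    "\<And>b. b \<in> B \<Longrightarrow> norm b = 1" "\<And>b. b \<in> B \<Longrightarrow> ?M *v b = (b \<bullet> (?M *v b)) *\<^sub>R b"
  proof -
    have "x \<bullet> (?M *v y) = (?M *v x) \<bullet> y" for x y
      by (metis inner_commute inner_gram)
    then show thesis
      using selfadjoint_orthonormal_eigenbasis[of "\<lambda>x. ?M *v x" UNIV] that by (auto simp: dim_UNIV)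
  qed
  define d where "d b = b \<bullet> (?M *v b)" for b
  have d_nonneg: "0 \<le> d b" for b
    unfolding d_def by (subst inner_commute) (simp add: inner_gram)
  have "proots (char_polynomial ?M) = (\<Sum>b\<in>B. {#d b#})"
    using char_polynomial_eigenbasis[OF B(1,4) B(5)[folded d_def] B(2)] by (simp add: proots_prod)
  also have "\<dots> = image_mset d (mset_set B)"
    using B(3) by (induction B) auto
  finally have roots: "proots (char_polynomial ?M) = image_mset d (mset_set B)" .
  obtain xs0 where xs0: "set xs0 = B" "distinct xs0"
    using finite_distinct_list[OF B(3)] by blast
  \<comment> \<open>The vectors are sorted by their eigenvalues, so each position of the list pairs
    an eigenvector with its eigenvalue. Repeated eigenvalues keep their multiplicity, since the list
    runs over distinct vectors.\<close>
  define xs where "xs = rev (sort_key d xs0)"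
  have xs: "set xs = B" "distinct xs" using xs0 by (auto simp: xs_def)
  have len: "length xs = CARD('m)" using xs B(2) by (metis distinct_card)
  have "sorted_list_of_multiset (proots (char_polynomial ?M)) = map d (sort_key d xs0)"
  proof -
    have "proots (char_polynomial ?M) = mset (map d (sort_key d xs0))"
      using xs0(2) by (simp add: roots mset_set_set flip: xs0(1))
    then show ?thesis
      by (metis sorted_list_of_multiset_mset sorted_sort_key sorted_sort_id)
  qed
  then have rl: "rev (sorted_list_of_multiset (proots (char_polynomial ?M))) = map d xs"
    by (simp add: xs_def rev_map)
  \<comment> \<open>Singular values are numbered from 1, list positions from 0.\<close>
  define v where "v i = xs ! (i - 1)" for i :: nat
  have vB: "v i \<in> B" if "i \<in> {1..CARD('m)}" for i
    using that len xs by (auto simp: v_def intro!: nth_mem)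
  have sv: "singular_value A k = sqrt (d (v k))" if "k \<in> {1..CARD('m)}" for k
    using that len by (auto simp: singular_value_def rl v_def)
  have on: "v i \<bullet> v j = (if i = j then 1 else 0)"
    if "i \<in> {1..CARD('m)}" "j \<in> {1..CARD('m)}" for i j
  proof -
    have "v i \<noteq> v j" if "i \<noteq> j"
      using that \<open>i \<in> _\<close> \<open>j \<in> _\<close> xs(2) len by (auto simp: v_def nth_eq_iff_index_eq)
    then show ?thesis
      using B(1,4) vB that by (auto simp: pairwise_def orthogonal_def norm_eq_1)
  qed
  have gram: "(A *v v i) \<bullet> (A *v v j) = (if i = j then (singular_value A i)\<^sup>2 else 0)"
    if "i \<in> {1..CARD('m)}" "j \<in> {1..CARD('m)}" for i j
  proof -
    have "(A *v v i) \<bullet> (A *v v j) = d (v i) * (v i \<bullet> v j)"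
      unfolding inner_gram[symmetric] B(5)[OF vB[OF that(1)], folded d_def] by simp
    then show ?thesis
      using on[OF that] sv[OF that(1)] d_nonneg by (cases "i = j") simp_all
  qed
  have nonneg: "singular_value A k \<ge> 0" for k
  proof (cases "k \<in> {1..CARD('m)}")
    case True
    then show ?thesis by (simp add: sv d_nonneg del: atLeastAtMost_iff)
  next
    case False
    then show ?thesis by (auto simp: singular_value_def)
  qed
  have "singular_value A k \<le> singular_value A j" if "1 \<le> j" "j \<le> k" for j k
  proof (cases "k \<le> CARD('m)")
    case True
    have "sorted_wrt (\<ge>) (map d xs)"
      unfolding xs_def rev_map[symmetric] by (simp add: sorted_wrt_rev)
    then have "d (v k) \<le> d (v j)" if "j < k"
      using that \<open>1 \<le> j\<close> True len unfolding sorted_wrt_iff_nth_less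
      by (auto simp: v_def dest!: spec[of _ "j - 1"] spec[of _ "k - 1"])
    then show ?thesis
      using that True by (cases "j = k") (auto simp: sv)
  next
    \<comment> \<open>Beyond the last index the conventional value 0 lies below every singular
      value.\<close>
    case False
    then have "singular_value A k = 0" by (simp add: singular_value_def)
    then show ?thesis using nonneg by simp
  qed
  then show thesis using that on gram nonneg by blast
qed

section \<open>Sums and spans of orthogonal systems\<close>

text \<open>Pythagoras for vectors of length \<open>\<bar>s i\<bar>\<close>, zero allowed. The shape
  of the hypothesis matches the Gram relation of the images \<open>A *v v i\<close> in
  \<open>singular_basis\<close>.\<close>

lemma norm_sum_orthogonal:
  fixes a :: "'i \<Rightarrow> 'a::real_inner" and s c :: "'i \<Rightarrow> real"
  assumes "finite I" and "\<And>i j. i \<in> I \<Longrightarrow> j \<in> I \<Longrightarrow> a i \<bullet> a j = (if i = j then (s i)\<^sup>2 else 0)"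
  shows "(norm (\<Sum>i\<in>I. c i *\<^sub>R a i))\<^sup>2 = (\<Sum>i\<in>I. (c i)\<^sup>2 * (s i)\<^sup>2)"
proof -
  have "(norm (\<Sum>i\<in>I. c i *\<^sub>R a i))\<^sup>2 = (\<Sum>i\<in>I. \<Sum>j\<in>I. c i * (c j * (a i \<bullet> a j)))"
    by (simp add: power2_norm_eq_inner inner_sum_left inner_sum_right sum_distrib_left)
      (simp add: inner_commute)
  also have "\<dots> = (\<Sum>i\<in>I. \<Sum>j\<in>I. if i = j then (c i)\<^sup>2 * (s i)\<^sup>2 else 0)"
    by (intro sum.cong refl) (auto simp: assms(2) power2_eq_square)
  finally show ?thesis
    using \<open>finite I\<close> by simp
qed

lemma norm_sum_orthonormal:
  fixes a :: "'i \<Rightarrow> 'a::real_inner" and c :: "'i \<Rightarrow> real"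
  assumes "finite I" and "\<And>i j. i \<in> I \<Longrightarrow> j \<in> I \<Longrightarrow> a i \<bullet> a j = (if i = j then 1 else 0)"
  shows "(norm (\<Sum>i\<in>I. c i *\<^sub>R a i))\<^sup>2 = (\<Sum>i\<in>I. (c i)\<^sup>2)"
proof -
  have "a i \<bullet> a j = (if i = j then 1\<^sup>2 else 0)" if "i \<in> I" "j \<in> I" for i j
    using assms(2)[OF that] by simp
  then show ?thesis
    using norm_sum_orthogonal[OF assms(1), of a "\<lambda>_. 1" c] by simp
qed

lemma dim_span_orthogonal:
  fixes a :: "'i \<Rightarrow> 'a::euclidean_space"
  assumes "\<And>i j. i \<in> I \<Longrightarrow> j \<in> I \<Longrightarrow> i \<noteq> j \<Longrightarrow> a i \<bullet> a j = 0" and "\<And>i. i \<in> I \<Longrightarrow> a i \<noteq> 0"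
  shows "dim (span (a ` I)) = card I"
proof -
  have "inj_on a I"
    by (rule inj_onI) (metis assms inner_eq_zero_iff)
  moreover have "independent (a ` I)"
    using assms by (intro pairwise_orthogonal_independent) (auto simp: pairwise_def orthogonal_def)
  ultimately show ?thesis
    by (simp add: dim_eq_card_independent card_image)
qed

lemma dim_span_orthonormal:
  fixes a :: "'i \<Rightarrow> 'a::euclidean_space"
  assumes on: "\<And>i j. i \<in> I \<Longrightarrow> j \<in> I \<Longrightarrow> a i \<bullet> a j = (if i = j then 1 else 0)"
  shows "dim (span (a ` I)) = card I"
proof (rule dim_span_orthogonal)
  show "a i \<noteq> 0" if "i \<in> I" for i
    using on[OF that that] by auto
qed (simp add: on)

text \<open>Indexed form of \<open>orthonormal_basis_expand\<close>: orthonormality makes the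
  indexing injective, so the sum over the set of vectors can be reindexed.\<close>

lemma orthonormal_expand:
  fixes a :: "'i \<Rightarrow> 'a::euclidean_space"
  assumes "finite I" and "\<And>i j. i \<in> I \<Longrightarrow> j \<in> I \<Longrightarrow> a i \<bullet> a j = (if i = j then 1 else 0)"
    and "z \<in> span (a ` I)"
  shows "(\<Sum>i\<in>I. (z \<bullet> a i) *\<^sub>R a i) = z"
proof -
  have inj: "inj_on a I"
    by (rule inj_onI) (metis assms(2) zero_neq_one)
  have "(\<Sum>b\<in>a ` I. (z \<bullet> b) *\<^sub>R b) = z"
    using assms by (intro orthonormal_basis_expand) (auto simp: pairwise_def orthogonal_def norm_eq_1)
  then show ?thesis
    by (simp add: sum.reindex[OF inj])
qed

section \<open>Spectral norm and deviation\<close>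

lemma norm_matrix_vector_le_spectral_norm: "norm (A *v x) \<le> spectral_norm A * norm x"
  unfolding spectral_norm_def by (intro onorm matrix_vector_mul_bounded_linear)

lemma spectral_norm_le: "(\<And>x. norm (A *v x) \<le> b * norm x) \<Longrightarrow> spectral_norm A \<le> b"
  unfolding spectral_norm_def by (rule onorm_le)

lemma outer_product_mult: "outer_product x y *v z = (y \<bullet> z) *\<^sub>R x"
  by (simp add: outer_product_def matrix_vector_mult_def vec_eq_iff inner_vec_def
      sum_distrib_left mult_ac)

text \<open>A subspace contains 0, so the default value of \<open>infdist\<close> for the empty set
  does not arise.\<close>

lemma deviation_eq_infdist:
  "subspace X \<Longrightarrow> deviation S X = (SUP a\<in>S. infdist a X)"
  using subspace_0[of X] by (auto simp: deviation_def infdist_def dist_norm)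

lemma infdist_le_deviation:
  assumes "subspace X" and "norm z \<le> 1"
  shows "infdist (A *v z) X \<le> deviation (unit_ball_image A) X"
proof -
  \<comment> \<open>A real supremum is an upper bound only for a bounded set; compactness of the
    image of the ball provides this.\<close>
  have "bdd_above ((\<lambda>a. infdist a X) ` unit_ball_image A)"
    by (intro bounded_imp_bdd_above compact_imp_bounded compact_continuous_image
        continuous_on_infdist continuous_on_id compact_unit_ball_image)
  then show ?thesis
    using assms unfolding deviation_eq_infdist[OF assms(1)]
    by (intro cSUP_upper) (auto simp: unit_ball_image_def)
qed

lemma deviation_le:
  assumes "subspace X" and "\<And>z. norm z \<le> 1 \<Longrightarrow> infdist (A *v z) X \<le> b"
  shows "deviation (unit_ball_image A) X \<le> b"
proof -
  have "A *v 0 \<in> unit_ball_image A"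
    unfolding unit_ball_image_def by fastforce
  then show ?thesis
    using assms unfolding deviation_eq_infdist[OF assms(1)]
    by (intro cSUP_least) (auto simp: unit_ball_image_def)
qed

lemma deviation_nonneg: "subspace X \<Longrightarrow> 0 \<le> deviation (unit_ball_image A) X"
  using order_trans[OF infdist_nonneg infdist_le_deviation[of X 0 A]] by simp

lemma spectral_norm_nonneg: "0 \<le> spectral_norm A"
  unfolding spectral_norm_def by (intro onorm_pos_le matrix_vector_mul_bounded_linear)

text \<open>The point \<open>B *v z\<close> of \<open>X\<close> is one candidate for approximating
  \<open>A *v z\<close>.\<close>

lemma deviation_le_spectral_norm:
  assumes "subspace X" and "range (\<lambda>z. B *v z) \<subseteq> X"
  shows "deviation (unit_ball_image A) X \<le> spectral_norm (A - B)"
proof (rule deviation_le[OF assms(1)])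
  fix z :: "real^'a" assume z: "norm z \<le> 1"
  have "infdist (A *v z) X \<le> dist (A *v z) (B *v z)"
    using assms(2) by (intro infdist_le) auto
  also have "\<dots> = norm ((A - B) *v z)"
    by (simp add: dist_norm matrix_vector_mult_diff_rdistrib)
  also have "\<dots> \<le> spectral_norm (A - B) * norm z"
    by (rule norm_matrix_vector_le_spectral_norm)
  also have "\<dots> \<le> spectral_norm (A - B)"
    using mult_left_mono[OF z spectral_norm_nonneg] by simp
  finally show "infdist (A *v z) X \<le> spectral_norm (A - B)" .
qed

text \<open>Moving \<open>A\<close> across the inner product gives
  \<open>y i \<bullet> z = x i \<bullet> (A *v z)\<close>, so the coefficients are those of the
  orthogonal projection of \<open>A *v z\<close>.\<close>

lemma projection_sum_mult:
  assumes "\<forall>i\<in>{1..n::nat}. y i = transpose A *v x i"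
  shows "(\<Sum>i=1..n. outer_product (x i) (y i)) *v z = (\<Sum>i=1..n. ((A *v z) \<bullet> x i) *\<^sub>R x i)"
proof -
  have "(\<Sum>i=1..n. outer_product (x i) (y i)) *v z = (\<Sum>i=1..n. outer_product (x i) (y i) *v z)"
    by (induction n) (auto simp: matrix_vector_mult_add_rdistrib)
  also have "\<dots> = (\<Sum>i=1..n. ((A *v z) \<bullet> x i) *\<^sub>R x i)"
    using assms by (intro sum.cong refl)
      (simp add: outer_product_mult transpose_matrix_vector dot_lmul_matrix inner_commute[of "A *v z"])
  finally show ?thesis .
qed

text \<open>The residual \<open>A *v z - R *v z\<close> is orthogonal to each \<open>x j\<close>,
  hence to \<open>X\<close>. By Pythagoras \<open>R *v z\<close> is then the point of
  \<open>X\<close> nearest to \<open>A *v z\<close>, and the two suprema over the unit ball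
  coincide.\<close>

lemma spectral_norm_projection:
  fixes x y :: "nat \<Rightarrow> real^'m"
  assumes on: "\<forall>i\<in>{1..n}. \<forall>j\<in>{1..n}. x i \<bullet> x j = (if i = j then 1 else 0)"
    and y: "\<forall>i\<in>{1..n}. y i = transpose A *v x i"
  defines "X \<equiv> span (x ` {1..n})" and "R \<equiv> (\<Sum>i=1..n. outer_product (x i) (y i))"
  shows "spectral_norm (A - R) = deviation (unit_ball_image A) X" and "range (\<lambda>z. R *v z) \<subseteq> X"
proof -
  have sub: "subspace X" by (simp add: X_def)
  have Rz: "R *v z = (\<Sum>i=1..n. ((A *v z) \<bullet> x i) *\<^sub>R x i)" for z
    using projection_sum_mult[OF y] by (simp add: R_def)
  show ran: "range (\<lambda>z. R *v z) \<subseteq> X"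
  proof clarify
    fix z show "R *v z \<in> X"
      unfolding Rz X_def by (rule span_sum, rule span_scale, rule span_base, rule imageI)
  qed
  have "norm ((A - R) *v z) = infdist (A *v z) X" for z
  proof -
    let ?e = "A *v z - R *v z"
    have ox: "?e \<bullet> x j = 0" if "j \<in> {1..n}" for j
    proof -
      have "(R *v z) \<bullet> x j = (\<Sum>i=1..n. if i = j then (A *v z) \<bullet> x j else 0)"
        unfolding Rz inner_sum_left using on that by (intro sum.cong) auto
      then show ?thesis using that by (simp add: inner_diff_left)
    qed
    have orth: "orthogonal ?e w" if "w \<in> X" for w
      using that unfolding X_def
      by (rule orthogonal_to_span) (use ox in \<open>auto simp: orthogonal_def\<close>)
    have "norm ?e \<le> dist (A *v z) w" if "w \<in> X" for w
    proof -
      have "R *v z - w \<in> X" using ran that sub by (intro subspace_diff) auto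
      then have "(norm (?e + (R *v z - w)))\<^sup>2 = (norm ?e)\<^sup>2 + (norm (R *v z - w))\<^sup>2"
        by (intro norm_add_Pythagorean orth)
      then have "(norm ?e)\<^sup>2 \<le> (dist (A *v z) w)\<^sup>2" by (simp add: dist_norm)
      then show ?thesis by (rule power2_le_imp_le) simp
    qed
    then have "norm ?e \<le> infdist (A *v z) X"
      using subspace_0[OF sub] by (auto simp: infdist_def intro!: cINF_greatest)
    moreover have "infdist (A *v z) X \<le> norm ?e"
      using ran infdist_le[of "R *v z" X "A *v z"] by (auto simp: dist_norm)
    ultimately show ?thesis by (simp add: matrix_vector_mult_diff_rdistrib)
  qed
  then have unit: "norm ((A - R) *v z) \<le> deviation (unit_ball_image A) X" if "norm z \<le> 1" for z
    using infdist_le_deviation[OF sub that] by simp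
  have "spectral_norm (A - R) \<le> deviation (unit_ball_image A) X"
  proof (rule spectral_norm_le)
    fix z
    show "norm ((A - R) *v z) \<le> deviation (unit_ball_image A) X * norm z"
    proof (cases "z = 0")
      case False
      then show ?thesis
        using unit[of "z /\<^sub>R norm z"]
        by (simp add: matrix_vector_mult_scaleR divide_simps mult.commute)
    qed simp
  qed
  then show "spectral_norm (A - R) = deviation (unit_ball_image A) X"
    using deviation_le_spectral_norm[OF sub ran, of A] by simp
qed

section \<open>Singular values as approximation errors (Eckart-Young)\<close>

lemma singular_value_nonneg: "0 \<le> singular_value A k"
  by (rule singular_basis)

lemma singular_value_antimono:
  "1 \<le> j \<Longrightarrow> j \<le> k \<Longrightarrow> singular_value A k \<le> singular_value A j"
  by (rule singular_basis[of A]) blast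

text \<open>Dimension count: the first \<open>n\<close> right singular vectors span a space of
  dimension \<open>n > rank B\<close>, so \<open>B\<close> annihilates some nonzero \<open>w\<close>
  in it. There \<open>A\<close> stretches every vector by at least
  \<open>singular_value A n\<close>, and \<open>A - B\<close> acts on \<open>w\<close> as
  \<open>A\<close> does.\<close>

lemma spectral_norm_diff_ge_singular_value:
  fixes A B :: "real^'m^'m"
  assumes "rank B < n" and "n \<le> CARD('m)"
  shows "singular_value A n \<le> spectral_norm (A - B)"
proof -
  obtain v :: "nat \<Rightarrow> real^'m" where
    on: "\<forall>i\<in>{1..CARD('m)}. \<forall>j\<in>{1..CARD('m)}. v i \<bullet> v j = (if i = j then 1 else 0)" and
    Av: "\<forall>i\<in>{1..CARD('m)}. \<forall>j\<in>{1..CARD('m)}.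
       (A *v v i) \<bullet> (A *v v j) = (if i = j then (singular_value A i)\<^sup>2 else 0)"
    by (rule singular_basis[of A]) blast
  let ?V = "span (v ` {1..n})"
  have on': "v i \<bullet> v j = (if i = j then 1 else 0)" if "i \<in> {1..n}" "j \<in> {1..n}" for i j
    using on that assms(2) by auto
  have "dim ?V = n"
    using dim_span_orthonormal[of "{1..n}" v, OF on'] by simp
  moreover have "dim ((*v) B ` ?V) \<le> rank B"
    unfolding rank_dim_range by (intro dim_subset) auto
  ultimately have "\<not> inj_on ((*v) B) ?V"
    using dim_image_eq[of "(*v) B" ?V] assms(1) by (auto simp: span_span)
  then obtain p q where pq: "p \<in> ?V" "q \<in> ?V" "B *v p = B *v q" "p \<noteq> q"
    by (auto simp: inj_on_def)
  define w where "w = p - q"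
  have w: "w \<in> ?V" "w \<noteq> 0" "B *v w = 0"
    using pq by (auto simp: w_def span_diff matrix_vector_mult_diff_distrib)
  define c where "c i = w \<bullet> v i" for i
  have w_eq: "w = (\<Sum>i=1..n. c i *\<^sub>R v i)"
    unfolding c_def using orthonormal_expand[OF _ on' w(1)] by simp
  have Aw_eq: "A *v w = (\<Sum>i=1..n. c i *\<^sub>R (A *v v i))"
    unfolding w_eq by (simp add: linear_sum[OF matrix_vector_mul_linear] matrix_vector_mult_scaleR)
  have "(singular_value A n * norm w)\<^sup>2 = (\<Sum>i=1..n. (c i)\<^sup>2 * (singular_value A n)\<^sup>2)"
    using norm_sum_orthonormal[of "{1..n}" v c, OF _ on'] unfolding w_eq[symmetric]
    by (simp add: power_mult_distrib sum_distrib_left mult.commute)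
  also have "\<dots> \<le> (\<Sum>i=1..n. (c i)\<^sup>2 * (singular_value A i)\<^sup>2)"
    by (intro sum_mono mult_left_mono power_mono singular_value_antimono singular_value_nonneg) auto
  also have "\<dots> = (norm (A *v w))\<^sup>2"
    unfolding Aw_eq using Av assms(2)
    by (intro norm_sum_orthogonal[symmetric]) auto
  finally have "singular_value A n * norm w \<le> norm (A *v w)"
    by (rule power2_le_imp_le) simp
  also have "\<dots> = norm ((A - B) *v w)"
    using w by (simp add: matrix_vector_mult_diff_rdistrib)
  also have "\<dots> \<le> spectral_norm (A - B) * norm w"
    by (rule norm_matrix_vector_le_spectral_norm)
  finally show ?thesis using w by simp
qed

text \<open>\<open>B\<close> agrees with \<open>A\<close> on the first \<open>n\<close> right
  singular vectors and annihilates the others. Positivity of \<open>singular_value A n\<close> keeps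
  the first \<open>n\<close> images nonzero, so the rank is exactly \<open>n\<close>.\<close>

lemma truncated_svd:
  fixes A :: "real^'m^'m"
  assumes "n \<le> CARD('m)" and "singular_value A n > 0"
  obtains B where "rank B = n" "spectral_norm (A - B) \<le> singular_value A (n + 1)"
proof -
  obtain v :: "nat \<Rightarrow> real^'m" where
    on: "\<forall>i\<in>{1..CARD('m)}. \<forall>j\<in>{1..CARD('m)}. v i \<bullet> v j = (if i = j then 1 else 0)" and
    Av: "\<forall>i\<in>{1..CARD('m)}. \<forall>j\<in>{1..CARD('m)}.
       (A *v v i) \<bullet> (A *v v j) = (if i = j then (singular_value A i)\<^sup>2 else 0)"
    by (rule singular_basis[of A]) blast
  have on': "v i \<bullet> v j = (if i = j then 1 else 0)"
    if "i \<in> {1..CARD('m)}" "j \<in> {1..CARD('m)}" for i j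
    using on that by auto
  have lin: "linear (\<lambda>z. \<Sum>i=1..n. (z \<bullet> v i) *\<^sub>R (A *v v i))"
    by (intro linear_compose_sum ballI linearI)
      (auto simp: inner_add_left scaleR_add_left)
  define B where "B = matrix (\<lambda>z. \<Sum>i=1..n. (z \<bullet> v i) *\<^sub>R (A *v v i))"
  have B: "B *v z = (\<Sum>i=1..n. (z \<bullet> v i) *\<^sub>R (A *v v i))" for z
    unfolding B_def matrix_vector_mul(2)[OF lin] ..
  have Bv: "B *v v j = A *v v j" if "j \<in> {1..n}" for j
  proof -
    have "B *v v j = (\<Sum>i=1..n. if i = j then A *v v j else 0)"
      unfolding B using that assms(1) by (intro sum.cong) (auto simp: on')
    then show ?thesis using that by simp
  qed
  have "range ((*v) B) = span ((\<lambda>i. A *v v i) ` {1..n})"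
  proof
    show "range ((*v) B) \<subseteq> span ((\<lambda>i. A *v v i) ` {1..n})"
    proof clarify
      fix z show "B *v z \<in> span ((\<lambda>i. A *v v i) ` {1..n})"
        unfolding B by (rule span_sum, rule span_scale, rule span_base, rule imageI)
    qed
    show "span ((\<lambda>i. A *v v i) ` {1..n}) \<subseteq> range ((*v) B)"
      using Bv[symmetric] by (intro span_minimal subspace_UNIV linear_subspace_image) auto
  qed
  moreover have "dim (span ((\<lambda>i. A *v v i) ` {1..n})) = card {1..n}"
  proof (rule dim_span_orthogonal)
    show "(A *v v i) \<bullet> (A *v v j) = 0" if "i \<in> {1..n}" "j \<in> {1..n}" "i \<noteq> j" for i j
      using Av that assms(1) by auto
    show "A *v v i \<noteq> 0" if "i \<in> {1..n}" for i
    proof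
      assume "A *v v i = 0"
      then have "(singular_value A i)\<^sup>2 = 0"
        using Av[rule_format, of i i] that assms(1) by simp
      then show False using singular_value_antimono[of i n A] that assms(2) by simp
    qed
  qed
  ultimately have "rank B = n" by (simp add: rank_dim_range)
  moreover have "spectral_norm (A - B) \<le> singular_value A (n + 1)"
  proof (rule spectral_norm_le)
    fix z
    define c where "c i = z \<bullet> v i" for i
    have "span (v ` {1..CARD('m)}) = UNIV"
    proof -
      have "dim (span (v ` {1..CARD('m)})) = CARD('m)"
        using dim_span_orthonormal[of "{1..CARD('m)}" v, OF on'] by simp
      then show ?thesis
        using dim_eq_full[of "v ` {1..CARD('m)}"] by (simp add: dim_UNIV)
    qed
    then have z: "(\<Sum>i=1..CARD('m). c i *\<^sub>R v i) = z"
      unfolding c_def using orthonormal_expand[of "{1..CARD('m)}" v z, OF _ on'] by simp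
    have "A *v z = (\<Sum>i=1..CARD('m). c i *\<^sub>R (A *v v i))"
      unfolding z[symmetric] by (simp add: linear_sum[OF matrix_vector_mul_linear] matrix_vector_mult_scaleR)
    also have "\<dots> = (\<Sum>i\<in>{1..n} \<union> {n+1..CARD('m)}. c i *\<^sub>R (A *v v i))"
      using assms(1) by (intro sum.cong) auto
    also have "\<dots> = B *v z + (\<Sum>i=n+1..CARD('m). c i *\<^sub>R (A *v v i))"
      unfolding B c_def by (intro sum.union_disjoint) auto
    finally have "(A - B) *v z = (\<Sum>i=n+1..CARD('m). c i *\<^sub>R (A *v v i))"
      by (simp add: matrix_vector_mult_diff_rdistrib)
    then have "(norm ((A - B) *v z))\<^sup>2 = (\<Sum>i=n+1..CARD('m). (c i)\<^sup>2 * (singular_value A i)\<^sup>2)"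
      using Av by (simp only:) (intro norm_sum_orthogonal, auto)
    \<comment> \<open>For \<open>n = CARD('m)\<close> the sum is empty, in accordance with
      \<open>singular_value A (n + 1) = 0\<close>.\<close>
    also have "\<dots> \<le> (\<Sum>i=n+1..CARD('m). (c i)\<^sup>2 * (singular_value A (n+1))\<^sup>2)"
      by (intro sum_mono mult_left_mono power_mono singular_value_antimono singular_value_nonneg) auto
    \<comment> \<open>Adding the nonnegative terms up to \<open>n\<close> completes the sum to the
      squared norm of \<open>z\<close>.\<close>
    also have "\<dots> \<le> (\<Sum>i=1..CARD('m). (c i)\<^sup>2 * (singular_value A (n+1))\<^sup>2)"
      by (intro sum_mono2) auto
    also have "\<dots> = (singular_value A (n+1) * norm z)\<^sup>2"
      using norm_sum_orthonormal[of "{1..CARD('m)}" v c, OF _ on'] unfolding z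
      by (simp add: power_mult_distrib sum_distrib_left mult.commute)
    finally show "norm ((A - B) *v z) \<le> singular_value A (n+1) * norm z"
      by (rule power2_le_imp_le) (simp add: singular_value_nonneg)
  qed
  ultimately show thesis by (rule that)
qed

section \<open>Kolmogorov widths and matrices of rank n\<close>

lemma kolmogorov_width_le:
  assumes "subspace X" and "dim X = n"
  shows "kolmogorov_width n (unit_ball_image A) \<le> deviation (unit_ball_image A) X"
  unfolding kolmogorov_width_def using assms
  by (intro cINF_lower bdd_belowI2[of _ 0]) (auto simp: deviation_nonneg)

text \<open>The bound on \<open>n\<close> supplies a subspace of dimension \<open>n\<close>, so the
  infimum is not taken over the empty set.\<close>

lemma kolmogorov_width_ge:
  fixes A :: "real^'m^'m"
  assumes "n \<le> CARD('m)"
    and "\<And>X. subspace X \<Longrightarrow> dim X = n \<Longrightarrow> b \<le> deviation (unit_ball_image A) X"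
  shows "b \<le> kolmogorov_width n (unit_ball_image A)"
proof -
  obtain X :: "(real^'m) set" where "subspace X" "dim X = n"
    using choose_subspace_of_subspace[of n "UNIV :: (real^'m) set"] assms(1) by (auto simp: dim_UNIV)
  then show ?thesis
    unfolding kolmogorov_width_def using assms(2) by (intro cINF_greatest) auto
qed

text \<open>The range of \<open>B\<close> is itself a competing subspace of dimension
  \<open>n\<close>.\<close>

lemma kolmogorov_width_le_spectral_norm:
  assumes "rank B = n"
  shows "kolmogorov_width n (unit_ball_image A) \<le> spectral_norm (A - B)"
proof -
  have sub: "subspace (range ((*v) B))"
    by (intro linear_subspace_image subspace_UNIV) auto
  have dim: "dim (range ((*v) B)) = n"
    using assms by (simp add: rank_dim_range)
  show ?thesis
    by (rule order_trans[OF kolmogorov_width_le[OF sub dim]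
          deviation_le_spectral_norm[OF sub subset_refl]])
qed

text \<open>An orthonormal basis of \<open>X\<close>, numbered from 1, brings an arbitrary subspace
  into the setting of \<open>spectral_norm_projection\<close>. Only an inclusion of the range is
  asserted, as the rank of \<open>R\<close> may be smaller than \<open>dim X\<close>.\<close>

lemma projection_attaining_deviation:
  fixes A :: "real^'m^'m"
  assumes "subspace X"
  obtains R where "spectral_norm (A - R) = deviation (unit_ball_image A) X" "range ((*v) R) \<subseteq> X"
proof -
  obtain B where B: "pairwise orthogonal B" "\<And>b. b \<in> B \<Longrightarrow> norm b = 1" "independent B" "span B = X"
    using orthonormal_basis_subspace[OF assms] by metis
  then obtain x where x: "bij_betw x {1..card B} B"
    using ex_bij_betw_nat_finite_1[of B] independent_imp_finite by blast
  then have xB: "x ` {1..card B} = B" by (simp add: bij_betw_def)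
  have "x i \<bullet> x j = (if i = j then 1 else 0)" if "i \<in> {1..card B}" "j \<in> {1..card B}" for i j
  proof -
    have "x i \<in> B" "x j \<in> B" "i \<noteq> j \<Longrightarrow> x i \<noteq> x j"
      using bij_betwE[OF x] inj_on_eq_iff[OF bij_betw_imp_inj_on[OF x]] that by auto
    then show ?thesis
      using B(1,2) by (auto simp: pairwise_def orthogonal_def norm_eq_1)
  qed
  then show thesis
    using that spectral_norm_projection[of "card B" x "\<lambda>i. transpose A *v x i" A] xB B(4) by auto
qed

section \<open>Norm identity and equivalence of the two minimization problems\<close>

theorem theorem1:
  fixes A :: "real^'m^'m" and r n :: nat
    and x y :: "nat \<Rightarrow> real^'m" and X :: "(real^'m) set"
  assumes "rank A = r"
    and "1 \<le> n" and "n \<le> CARD('m)"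
    and "\<forall>i\<in>{1..n}. \<forall>j\<in>{1..n}. x i \<bullet> x j = (if i = j then 1 else 0)"
    and "\<forall>i\<in>{1..n}. y i = transpose A *v x i"
    and "X = span (x ` {1..n})"
  shows "spectral_norm (A - (\<Sum>i=1..n. outer_product (x i) (y i))) =
           deviation (unit_ball_image A) X \<and>
         (n < r \<and>
          singular_value A n > singular_value A (n + 1) \<and>
          singular_value A (n + 1) > singular_value A (n + 2) \<and>
          singular_value A (n + 2) \<ge> 0 \<longrightarrow>
          (best_rank_approximation n A (\<Sum>i=1..n. outer_product (x i) (y i)) \<longleftrightarrow>
           optimal_subspace n (unit_ball_image A) X))"
proof (intro conjI impI)
  define R where "R = (\<Sum>i=1..n. outer_product (x i) (y i))"
  have dev: "spectral_norm (A - R) = deviation (unit_ball_image A) X"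
    and ran: "range ((*v) R) \<subseteq> X"
    using spectral_norm_projection[OF assms(4,5)] by (simp_all add: R_def assms(6))
  then show "spectral_norm (A - (\<Sum>i=1..n. outer_product (x i) (y i))) =
      deviation (unit_ball_image A) X"
    by (simp add: R_def)
  assume "n < r \<and> singular_value A n > singular_value A (n + 1) \<and>
    singular_value A (n + 1) > singular_value A (n + 2) \<and> singular_value A (n + 2) \<ge> 0"
  then have gap: "singular_value A (n + 1) < singular_value A n" by blast
  have sub: "subspace X" and dim: "dim X = n"
    using dim_span_orthonormal[of "{1..n}" x] assms(4) by (simp_all add: assms(6))
  have rank_le: "rank B \<le> dim Y" if "range ((*v) B) \<subseteq> Y" for B :: "real^'m^'m" and Y
    unfolding rank_dim_range using that by (rule dim_subset)
  \<comment> \<open>The gap and nonnegativity make \<open>singular_value A n\<close> positive, as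
    the truncation requires.\<close>
  obtain B0 :: "real^'m^'m" where
    B0: "rank B0 = n" "spectral_norm (A - B0) \<le> singular_value A (n + 1)"
    using truncated_svd[OF assms(3)] le_less_trans[OF singular_value_nonneg gap] by blast
  have low: "spectral_norm (A - B0) < spectral_norm (A - B)" if "rank B < n" for B
    using spectral_norm_diff_ge_singular_value[OF that assms(3), of A] B0(2) gap by simp
  show "best_rank_approximation n A (\<Sum>i=1..n. outer_product (x i) (y i)) \<longleftrightarrow>
    optimal_subspace n (unit_ball_image A) X"
    unfolding R_def[symmetric]
  proof
    assume best: "best_rank_approximation n A R"
    have "deviation (unit_ball_image A) X \<le> deviation (unit_ball_image A) Y"
      if Y: "subspace Y" "dim Y = n" for Y
    proof -
      obtain B where B: "spectral_norm (A - B) = deviation (unit_ball_image A) Y"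
        "range ((*v) B) \<subseteq> Y"
        using projection_attaining_deviation[OF Y(1)] by metis
      then have "rank B \<le> n" using rank_le[OF B(2)] Y by simp
      \<comment> \<open>Minimality of \<open>R\<close> concerns rank exactly \<open>n\<close>; a
        competitor of smaller rank is beaten by \<open>B0\<close>, and \<open>R\<close> is at least
        as good as \<open>B0\<close>.\<close>
      then consider "rank B = n" | "rank B < n" by linarith
      then have "spectral_norm (A - R) \<le> spectral_norm (A - B)"
      proof cases
        case 1
        then show ?thesis using best by (simp add: best_rank_approximation_def)
      next
        case 2
        have "spectral_norm (A - R) \<le> spectral_norm (A - B0)"
          using best B0(1) by (simp add: best_rank_approximation_def)
        then show ?thesis using low[OF 2] by simp
      qed
      then show ?thesis using dev B by simp
    qed
    then show "optimal_subspace n (unit_ball_image A) X"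
      using sub dim kolmogorov_width_le[OF sub dim, of A] kolmogorov_width_ge[OF assms(3)]
      by (auto simp: optimal_subspace_def intro!: antisym)
  next
    assume "optimal_subspace n (unit_ball_image A) X"
    then have le: "spectral_norm (A - R) \<le> spectral_norm (A - B)" if "rank B = n" for B
      using kolmogorov_width_le_spectral_norm[OF that, of A] dev by (simp add: optimal_subspace_def)
    \<comment> \<open>If the projection lost rank, \<open>B0\<close> would have a strictly smaller
      error than \<open>R\<close>, against \<open>le\<close>. The reverse bound on the rank comes
      from the range lying in \<open>X\<close>.\<close>
    then have "\<not> rank R < n"
      using low[of R] le[OF B0(1)] by auto
    then show "best_rank_approximation n A R"
      using le rank_le[OF ran] dim by (simp add: best_rank_approximation_def)
  qed
qed

end
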